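(* Let $A\in\mathbb{R}^{m\times n}$, and let $P\in\mathbb{R}^{m\times p}$ and $Q\in\mathbb{R}^{n\times q}$ satisfy $$\mathrm{rank}(P^TA) = \mathrm{rank}(AQ) = \mathrm{rank}(A).$$ Then, for any $\{1\}$-inverse $(P^TA)^g$ of $P^TA$ and any $\{1\}$-inverse $(AQ)^g$ of $AQ$, the matrix $$A^g = (P^TA)^g\,P^TAQ\,(AQ)^g$$ is a generalized $\{1,2\}$-inverse of $A$.
   Context: All matrices are real. A $\{1\}$-inverse of a matrix $M$ is any matrix $G$ with $MGM=M$. A $\{1,2\}$-inverse of $M$ is any matrix $G$ with $MGM=M$ and $GMG=G$. *)

theory Defs
  imports "HOL-Analysis.Analysis"
begin

definition is_1_inverse :: "real ^ 'n ^ 'm \<Rightarrow> real ^ 'm ^ 'n \<Rightarrow> bool" where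
  "is_1_inverse M G \<longleftrightarrow> M ** G ** M = M"

definition is_12_inverse :: "real ^ 'n ^ 'm \<Rightarrow> real ^ 'm ^ 'n \<Rightarrow> bool" where
  "is_12_inverse M G \<longleftrightarrow> M ** G ** M = M \<and> G ** M ** G = G"

end

theory Submission
  imports Defs
begin

text \<open>Multiplying by \<open>Q\<close> on the right can only shrink the column space, so equality of ranks
  means that \<open>A ** Q\<close> and \<open>A\<close> have the same column space. The matrix \<open>A ** Q ** H\<close> fixes every
  vector in that space, so \<open>A ** Q ** H ** A = A\<close>; transposing gives
  \<open>A ** G ** transpose P ** A = A\<close>. The two required equations follow from these two
  by associativity alone.\<close>

lemma range_matrix_mult_eq_if_rank_eq:
  fixes A :: "real ^ 'n ^ 'm" and Q :: "real ^ 'q ^ 'n"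
  assumes "rank (A ** Q) = rank A"
  shows "range ((*v) (A ** Q)) = range ((*v) A)"
proof (rule subspace_dim_equal)
  show "subspace (range ((*v) (A ** Q)))" "subspace (range ((*v) A))"
    by (simp_all add: linear_subspace_image)
  show "range ((*v) (A ** Q)) \<subseteq> range ((*v) A)"
    by (auto simp: matrix_vector_mul_assoc [symmetric])
  show "dim (range ((*v) (A ** Q))) \<ge> dim (range ((*v) A))"
    using assms by (simp add: rank_dim_range)
qed

text \<open>Since \<open>(A ** Q) ** H ** (A ** Q) = A ** Q\<close>, the matrix
  \<open>A ** Q ** H\<close> acts as the identity on the column space of \<open>A ** Q\<close>,
  which the rank condition identifies with that of \<open>A\<close>.\<close>

lemma one_inverse_right_multiple:
  fixes A :: "real ^ 'n ^ 'm" and Q :: "real ^ 'q ^ 'n"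
  assumes "rank (A ** Q) = rank A" and H: "is_1_inverse (A ** Q) H"
  shows "A ** Q ** H ** A = A"
proof -
  have "(A ** Q ** H ** A) *v x = A *v x" for x
  proof -
    \<comment> \<open>Writing \<open>A *v x\<close> through \<open>A ** Q\<close> gives
      \<open>H\<close> a second factor \<open>A ** Q\<close> to cancel against.\<close>
    obtain y where y: "A *v x = (A ** Q) *v y"
      using range_matrix_mult_eq_if_rank_eq [OF assms(1)] by blast
    have "(A ** Q ** H ** A) *v x = (A ** Q ** H) *v ((A ** Q) *v y)"
      by (simp add: y flip: matrix_vector_mul_assoc)
    also have "\<dots> = (A ** Q ** H ** (A ** Q)) *v y"
      by (rule matrix_vector_mul_assoc)
    also have "\<dots> = A *v x"
      using H by (simp add: is_1_inverse_def y)
    finally show ?thesis .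
  qed
  then show ?thesis
    by (simp add: matrix_eq)
qed

lemma is_1_inverse_transpose:
  fixes M :: "real ^ 'n ^ 'm"
  assumes "is_1_inverse M G"
  shows "is_1_inverse (transpose M) (transpose G)"
  using assms unfolding is_1_inverse_def
  by (metis matrix_mul_assoc matrix_transpose_mul)

text \<open>Mirror image of \<open>one_inverse_right_multiple\<close>: transposition preserves rank
  and turns the left factor \<open>R\<close> into a right factor \<open>transpose R\<close>.\<close>

lemma one_inverse_left_multiple:
  fixes A :: "real ^ 'n ^ 'm" and R :: "real ^ 'm ^ 'p"
  assumes "rank (R ** A) = rank A" and "is_1_inverse (R ** A) G"
  shows "A ** G ** R ** A = A"
proof -
  have "transpose A ** transpose R ** transpose G ** transpose A = transpose A"
  proof (rule one_inverse_right_multiple)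
    show "rank (transpose A ** transpose R) = rank (transpose A)"
      using assms(1) by (simp add: rank_transpose flip: matrix_transpose_mul)
    show "is_1_inverse (transpose A ** transpose R) (transpose G)"
      using is_1_inverse_transpose [OF assms(2)] by (simp add: matrix_transpose_mul)
  qed
  then have "transpose (A ** G ** R ** A) = transpose A"
    by (simp add: matrix_transpose_mul matrix_mul_assoc)
  then show ?thesis
    by (metis transpose_transpose)
qed

theorem theorem5:
  fixes A :: "real ^ 'n ^ 'm"
    and P :: "real ^ 'p ^ 'm"
    and Q :: "real ^ 'q ^ 'n"
    and G :: "real ^ 'p ^ 'n"
    and H :: "real ^ 'm ^ 'q"
  assumes "rank (transpose P ** A) = rank A"
    and "rank (A ** Q) = rank A"
    and "is_1_inverse (transpose P ** A) G"
    and "is_1_inverse (A ** Q) H"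
  shows "is_12_inverse A (G ** transpose P ** A ** Q ** H)"
proof -
  have left: "A ** G ** transpose P ** A = A"
    using assms by (intro one_inverse_left_multiple)
  have right: "A ** Q ** H ** A = A"
    using assms by (intro one_inverse_right_multiple)
  have "A ** (G ** transpose P ** A ** Q ** H) ** A = (A ** G ** transpose P ** A) ** Q ** H ** A"
    by (simp only: matrix_mul_assoc)
  also have "\<dots> = A"
    by (simp only: left right)
  finally have outer: "A ** (G ** transpose P ** A ** Q ** H) ** A = A" .
  \<comment> \<open>The inner block \<open>A ** Q ** H ** A\<close> collapses first; the
    \<open>A\<close> that remains then completes the block
    \<open>A ** G ** transpose P ** A\<close>.\<close>
  have "G ** transpose P ** A ** Q ** H ** A ** (G ** transpose P ** A ** Q ** H)
      = G ** transpose P ** (A ** Q ** H ** A) ** G ** transpose P ** A ** Q ** H"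
    by (simp only: matrix_mul_assoc)
  also have "\<dots> = G ** transpose P ** (A ** G ** transpose P ** A) ** Q ** H"
    by (simp only: right matrix_mul_assoc)
  also have "\<dots> = G ** transpose P ** A ** Q ** H"
    by (simp only: left)
  finally show ?thesis
    using outer by (simp add: is_12_inverse_def)
qed

end
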